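(* Let a system with coordinates $q=(q_1,\dots,q_n)$, $n=m+k$, be subject to the kinematic constraints $\dot q_{m+\nu}=\alpha_\nu(q_1,\dots,q_n,\dot q_1,\dots,\dot q_m,t)$, $\nu=1,\dots,k$, and to active forces $\mathcal F=\nabla_{\bf X}\mathcal U({\bf X},t)$ coming from a potential $\mathcal U$, so that $\mathcal F^{(q_i)}=\partial U/\partial q_i$ for $i=1,\dots,n$, where $U(q_1,\dots,q_n,t)=\mathcal U({\bf X}(q_1,\dots,q_n,t),t)$. Let $\mathcal L^*=T^*+U$. Assume that $$\sum_{i=1}^m\dot q_i\frac{\partial\alpha_\nu}{\partial\dot q_i}=\alpha_\nu\qquad\text{for every }\nu=1,\dots,k.$$ Then, along every solution of the equations of motion $$\frac{d}{dt}\frac{\partial T^*}{\partial \dot q_i}-\frac{\partial T^*}{\partial q_i}-\sum_{\nu=1}^k\frac{\partial T^*}{\partial q_{m+\nu}}\frac{\partial\alpha_\nu}{\partial\dot q_i}-\sum_{\nu=1}^k B_i^\nu\frac{\partial T}{\partial\dot q_{m+\nu}}=\mathcal F^{(q_i)}+\sum_{\nu=1}^k\frac{\partial\alpha_\nu}{\partial\dot q_i}\mathcal F^{(q_{m+\nu})},\qquad i=1,\dots,m,$$ joined with the constraint equations, the energy balance takes the form $$\frac{d}{dt}\left(\sum_{i=1}^m\dot q_i\frac{\partial\mathcal L^*}{\partial\dot q_i}-\mathcal L^*\right)=-\frac{\partial\mathcal L^*}{\partial t}+\sum_{\nu=1}^k\frac{\partial T}{\partial\dot q_{m+\nu}}\frac{\partial\alpha_\nu}{\partial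 t}.$$
   Context: All functions are assumed as smooth as needed. ${\bf X}(q_1,\dots,q_n,t)\in\mathbb R^{3N}$ gives the positions of $N$ material points $P_1,\dots,P_N$ with masses $M_1,\dots,M_N>0$, and ${\bf X}^{(\mathsf M)}=(M_1P_1,\dots,M_NP_N)$. The kinetic energy is $T(q_1,\dots,q_n,\dot q_1,\dots,\dot q_n,t)=\frac12\dot{\bf X}^{(\mathsf M)}\cdot\dot{\bf X}$, with $\dot{\bf X}=\sum_{i=1}^n\frac{\partial{\bf X}}{\partial q_i}\dot q_i+\frac{\partial{\bf X}}{\partial t}$ (and the same for ${\bf X}^{(\mathsf M)}$). For active forces $\mathcal F\in\mathbb R^{3N}$, the generalized forces are $\mathcal F^{(q_j)}=\mathcal F\cdot\frac{\partial{\bf X}}{\partial q_j}$, $j=1,\dots,n$. Given the constraint functions $\alpha_\nu(q_1,\dots,q_n,\dot q_1,\dots,\dot q_m,t)$, $\nu=1,\dots,k$, the restricted kinetic energy is $T^*(q_1,\dots,q_n,\dot q_1,\dots,\dot q_m,t)=T(q_1,\dots,q_n,\dot q_1,\dots,\dot q_m,\alpha_1,\dots,\alpha_k,t)$, and $\mathcal L^*(q_1,\dots,q_n,\dot q_1,\dots,\dot q_m,t)=T^*(q_1,\dots,q_n,\dot q_1,\dots,\dot q_m,t)+U(q_1,\dots,q_n,t)$. In $\partial T/\partial\dot q_{m+\nu}$ the derivative of the unrestricted $T$ is taken first and then $\dot q_{m+1},\dots,\dot q_n$ are replaced by $\alpha_1,\dots,\alpha_k$. Partial derivatives of $T^*,\mathcal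 L^*,\alpha_\nu$ are with respect to the independent arguments $(q_1,\dots,q_n,\dot q_1,\dots,\dot q_m,t)$. The coefficients in the equations of motion are $$B_i^\nu=\sum_{r=1}^m\left(\frac{\partial^2\alpha_\nu}{\partial\dot q_i\partial q_r}\dot q_r+\frac{\partial^2\alpha_\nu}{\partial\dot q_i\partial\dot q_r}\ddot q_r\right)-\frac{\partial\alpha_\nu}{\partial q_i}+\sum_{\mu=1}^k\left(\frac{\partial^2\alpha_\nu}{\partial\dot q_i\partial q_{m+\mu}}\alpha_\mu-\frac{\partial\alpha_\mu}{\partial\dot q_i}\frac{\partial\alpha_\nu}{\partial q_{m+\mu}}\right)+\frac{\partial^2\alpha_\nu}{\partial\dot q_i\partial t}.$$ The total derivative $\frac{d}{dt}$ is taken along a motion $t\mapsto q(t)$ satisfying the constraints. *)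

theory Defs
  imports "HOL-Analysis.Analysis"
begin

text \<open>
  The coordinates are indexed by the sum type \<open>'m + 'k\<close>: \<open>Inl i\<close> is one of the \<open>m\<close> coordinates with
  independent velocity, \<open>Inr \<nu>\<close> is the coordinate \<open>q\<^sub>m\<^sub>+\<^sub>\<nu>\<close> whose velocity is prescribed by \<open>\<alpha>\<^sub>\<nu>\<close>.
  A function of \<open>(q, v, t)\<close> is a function on a product space; \<open>v\<close> is the vector of all the
  velocities (for \<open>T\<close>) or of the \<open>m\<close> independent ones (for \<open>\<alpha>\<^sub>\<nu>\<close>, \<open>T\<^sup>*\<close>, \<open>L\<^sup>*\<close>).
\<close>

definition C1_on :: "'a::real_normed_vector set \<Rightarrow> ('a \<Rightarrow> 'b::real_normed_vector) \<Rightarrow> bool" where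
  "C1_on S f \<longleftrightarrow>
     (\<exists>f'. (\<forall>x\<in>S. (f has_derivative blinfun_apply (f' x)) (at x)) \<and> continuous_on S f')"

definition C2_on :: "'a::real_normed_vector set \<Rightarrow> ('a \<Rightarrow> 'b::real_normed_vector) \<Rightarrow> bool" where
  "C2_on S f \<longleftrightarrow>
     (\<exists>f'. (\<forall>x\<in>S. (f has_derivative blinfun_apply (f' x)) (at x)) \<and> C1_on S f')"

definition dir_deriv ::
    "'a::real_normed_vector \<Rightarrow> ('a \<Rightarrow> 'b::real_normed_vector) \<Rightarrow> 'a \<Rightarrow> 'b" where
  "dir_deriv e f x = vector_derivative (\<lambda>h. f (x + h *\<^sub>R e)) (at 0)"

text \<open>Partial derivatives of functions of \<open>(q, t)\<close>.\<close>

definition pd_q :: "'n \<Rightarrow> ((real^'n::finite) \<times> real \<Rightarrow> 'b::real_normed_vector) \<Rightarrow> (real^'n) \<times> real \<Rightarrow> 'b" where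
  "pd_q j = dir_deriv (axis j 1, 0)"

definition pd_t :: "((real^'n::finite) \<times> real \<Rightarrow> 'b::real_normed_vector) \<Rightarrow> (real^'n) \<times> real \<Rightarrow> 'b" where
  "pd_t = dir_deriv (0, 1)"

text \<open>Partial derivatives of functions of \<open>(q, v, t)\<close>.\<close>

definition D_q :: "'n \<Rightarrow> ((real^'n::finite) \<times> (real^'v::finite) \<times> real \<Rightarrow> real)
    \<Rightarrow> (real^'n) \<times> (real^'v) \<times> real \<Rightarrow> real" where
  "D_q j = dir_deriv (axis j 1, 0, 0)"

definition D_v :: "'v \<Rightarrow> ((real^'n::finite) \<times> (real^'v::finite) \<times> real \<Rightarrow> real)
    \<Rightarrow> (real^'n) \<times> (real^'v) \<times> real \<Rightarrow> real" where
  "D_v i = dir_deriv (0, axis i 1, 0)"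

definition D_t :: "((real^'n::finite) \<times> (real^'v::finite) \<times> real \<Rightarrow> real)
    \<Rightarrow> (real^'n) \<times> (real^'v) \<times> real \<Rightarrow> real" where
  "D_t = dir_deriv (0, 0, 1)"

text \<open>The space \<open>\<real>\<^sup>3\<^sup>N\<close> of configurations of \<open>N\<close> material points, indexed by \<open>'p\<close>.\<close>

type_synonym 'p config = "(real^3)^'p"

definition mass_scaled :: "('p \<Rightarrow> real) \<Rightarrow> ('p::finite) config \<Rightarrow> 'p config" where
  "mass_scaled M x = (\<chi> p. M p *\<^sub>R x $ p)"

definition velocity :: "((real^'n::finite) \<times> real \<Rightarrow> ('p::finite) config)
    \<Rightarrow> (real^'n) \<times> (real^'n) \<times> real \<Rightarrow> 'p config" where
  "velocity X = (\<lambda>(q, v, t). (\<Sum>j\<in>UNIV. v $ j *\<^sub>R pd_q j X (q, t)) + pd_t X (q, t))"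

definition kinetic_energy :: "('p \<Rightarrow> real) \<Rightarrow> ((real^'n::finite) \<times> real \<Rightarrow> ('p::finite) config)
    \<Rightarrow> (real^'n) \<times> (real^'n) \<times> real \<Rightarrow> real" where
  "kinetic_energy M X s = 1/2 * (velocity (mass_scaled M \<circ> X) s \<bullet> velocity X s)"

definition gen_force :: "('p config \<times> real \<Rightarrow> 'p config) \<Rightarrow>
    ((real^'n::finite) \<times> real \<Rightarrow> ('p::finite) config) \<Rightarrow> 'n \<Rightarrow> (real^'n) \<times> real \<Rightarrow> real" where
  "gen_force F X j = (\<lambda>(q, t). F (X (q, t), t) \<bullet> pd_q j X (q, t))"

type_synonym ('m, 'k) state = "(real^('m + 'k)) \<times> (real^'m) \<times> real"

text \<open>Insertion of the constraints: \<open>(q, v, t) \<mapsto> (q, (v, \<alpha>(q, v, t)), t)\<close>.\<close>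

definition constrained :: "('k \<Rightarrow> ('m::finite, 'k::finite) state \<Rightarrow> real)
    \<Rightarrow> ('m, 'k) state \<Rightarrow> (real^('m + 'k)) \<times> (real^('m + 'k)) \<times> real" where
  "constrained \<alpha> = (\<lambda>(q, v, t).
     (q, \<chi> j. case j of Inl i \<Rightarrow> v $ i | Inr \<nu> \<Rightarrow> \<alpha> \<nu> (q, v, t), t))"

definition restricted_kinetic_energy ::
    "('p \<Rightarrow> real) \<Rightarrow> ((real^('m + 'k)) \<times> real \<Rightarrow> ('p::finite) config)
      \<Rightarrow> ('k \<Rightarrow> ('m::finite, 'k::finite) state \<Rightarrow> real) \<Rightarrow> ('m, 'k) state \<Rightarrow> real" where
  "restricted_kinetic_energy M X \<alpha> s = kinetic_energy M X (constrained \<alpha> s)"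

text \<open>The derivative of the unrestricted \<open>T\<close> with respect to the velocity of \<open>q\<^sub>m\<^sub>+\<^sub>\<nu>\<close>, after which the
  dependent velocities are replaced.\<close>

definition dependent_momentum ::
    "('p \<Rightarrow> real) \<Rightarrow> ((real^('m + 'k)) \<times> real \<Rightarrow> ('p::finite) config)
      \<Rightarrow> ('k \<Rightarrow> ('m::finite, 'k::finite) state \<Rightarrow> real) \<Rightarrow> 'k \<Rightarrow> ('m, 'k) state \<Rightarrow> real" where
  "dependent_momentum M X \<alpha> \<nu> s = D_v (Inr \<nu>) (kinetic_energy M X) (constrained \<alpha> s)"

definition restricted_lagrangian ::
    "('p \<Rightarrow> real) \<Rightarrow> ((real^('m + 'k)) \<times> real \<Rightarrow> ('p::finite) config) \<Rightarrow> ('p config \<times> real \<Rightarrow> real)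
      \<Rightarrow> ('k \<Rightarrow> ('m::finite, 'k::finite) state \<Rightarrow> real) \<Rightarrow> ('m, 'k) state \<Rightarrow> real" where
  "restricted_lagrangian M X \<U> \<alpha> = (\<lambda>(q, v, t).
     restricted_kinetic_energy M X \<alpha> (q, v, t) + \<U> (X (q, t), t))"

text \<open>The argument \<open>a\<close> stands for the accelerations of the \<open>m\<close> independent coordinates.\<close>

definition B_coeff :: "('k \<Rightarrow> ('m::finite, 'k::finite) state \<Rightarrow> real)
    \<Rightarrow> 'm \<Rightarrow> 'k \<Rightarrow> ('m, 'k) state \<Rightarrow> real^'m \<Rightarrow> real" where
  "B_coeff \<alpha> i \<nu> s a =
     (\<Sum>r\<in>UNIV. D_v i (D_q (Inl r) (\<alpha> \<nu>)) s * fst (snd s) $ r + D_v i (D_v r (\<alpha> \<nu>)) s * a $ r)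
     - D_q (Inl i) (\<alpha> \<nu>) s
     + (\<Sum>\<mu>\<in>UNIV. D_v i (D_q (Inr \<mu>) (\<alpha> \<nu>)) s * \<alpha> \<mu> s - D_v i (\<alpha> \<mu>) s * D_q (Inr \<mu>) (\<alpha> \<nu>) s)
     + D_v i (D_t (\<alpha> \<nu>)) s"

definition indep_part :: "(real^('m::finite + 'k::finite)) \<Rightarrow> real^'m" where
  "indep_part x = (\<chi> i. x $ Inl i)"

definition motion_velocity :: "(real \<Rightarrow> real^'n::finite) \<Rightarrow> real \<Rightarrow> real^'n" where
  "motion_velocity q t = vector_derivative q (at t)"

definition motion_acceleration :: "(real \<Rightarrow> real^'n::finite) \<Rightarrow> real \<Rightarrow> real^'n" where
  "motion_acceleration q t = vector_derivative (motion_velocity q) (at t)"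

definition motion_state :: "(real \<Rightarrow> (real^('m::finite + 'k::finite))) \<Rightarrow> real \<Rightarrow> ('m, 'k) state" where
  "motion_state q t = (q t, indep_part (motion_velocity q t), t)"

definition satisfies_constraints :: "('k \<Rightarrow> ('m::finite, 'k::finite) state \<Rightarrow> real)
    \<Rightarrow> (real \<Rightarrow> (real^('m + 'k))) \<Rightarrow> real \<Rightarrow> bool" where
  "satisfies_constraints \<alpha> q t \<longleftrightarrow>
     (\<forall>\<nu>. motion_velocity q t $ Inr \<nu> = \<alpha> \<nu> (motion_state q t))"

definition satisfies_motion_eqs ::
    "('p \<Rightarrow> real) \<Rightarrow> ((real^('m + 'k)) \<times> real \<Rightarrow> ('p::finite) config)
      \<Rightarrow> ('p config \<times> real \<Rightarrow> 'p config) \<Rightarrow> ('k \<Rightarrow> ('m::finite, 'k::finite) state \<Rightarrow> real)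
      \<Rightarrow> (real \<Rightarrow> (real^('m + 'k))) \<Rightarrow> real \<Rightarrow> bool" where
  "satisfies_motion_eqs M X F \<alpha> q t \<longleftrightarrow>
     (let T = restricted_kinetic_energy M X \<alpha>; s = motion_state q t in
      \<forall>i. deriv (\<lambda>\<tau>. D_v i T (motion_state q \<tau>)) t
          - D_q (Inl i) T s
          - (\<Sum>\<nu>\<in>UNIV. D_q (Inr \<nu>) T s * D_v i (\<alpha> \<nu>) s)
          - (\<Sum>\<nu>\<in>UNIV. B_coeff \<alpha> i \<nu> s (indep_part (motion_acceleration q t))
                         * dependent_momentum M X \<alpha> \<nu> s)
        = gen_force F X (Inl i) (q t, t)
          + (\<Sum>\<nu>\<in>UNIV. D_v i (\<alpha> \<nu>) s * gen_force F X (Inr \<nu>) (q t, t)))"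

end

theory Submission
  imports Defs
begin

text \<open>
  Write \<open>P\<^sub>i\<close> for \<open>\<partial>T\<^sup>*/\<partial>v\<^sub>i\<close>, which is also \<open>\<partial>L\<^sup>*/\<partial>v\<^sub>i\<close> because \<open>U\<close> does not involve the velocities.
  By the product rule and the chain rule, the accelerations cancel in the derivative of the energy
  along the motion:

  \<open>d/dt (\<Sum>\<^sub>i v\<^sub>i P\<^sub>i - L\<^sup>*) = \<Sum>\<^sub>i v\<^sub>i dP\<^sub>i/dt - \<Sum>\<^sub>j (dq\<^sub>j/dt) \<partial>L\<^sup>*/\<partial>q\<^sub>j - \<partial>L\<^sup>*/\<partial>t\<close>.

  The power \<open>\<Sum>\<^sub>i v\<^sub>i dP\<^sub>i/dt\<close> is read off from the equations of motion, contracted with \<open>v\<^sub>i\<close>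
  (\<open>power_balance\<close>). The Euler identity \<open>\<Sum>\<^sub>i v\<^sub>i \<partial>\<alpha>\<^sub>\<nu>/\<partial>v\<^sub>i = \<alpha>\<^sub>\<nu>\<close> turns the terms weighted by
  \<open>\<partial>\<alpha>\<^sub>\<nu>/\<partial>v\<^sub>i\<close> into terms weighted by \<open>\<alpha>\<^sub>\<nu>\<close>, which is the velocity of \<open>q\<^sub>m\<^sub>+\<^sub>\<nu>\<close>; since the generalized
  forces are the derivatives of \<open>U\<close> (\<open>D_q_potential\<close>), these terms add up to
  \<open>\<Sum>\<^sub>j (dq\<^sub>j/dt) \<partial>L\<^sup>*/\<partial>q\<^sub>j\<close>. What is left over is the sum of the \<open>(\<Sum>\<^sub>i v\<^sub>i B\<^sub>i\<^sup>\<nu>) \<partial>T/\<partial>v\<^sub>m\<^sub>+\<^sub>\<nu>\<close>.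

  The heart of the matter is therefore the identity \<open>\<Sum>\<^sub>i v\<^sub>i B\<^sub>i\<^sup>\<nu> = \<partial>\<alpha>\<^sub>\<nu>/\<partial>t\<close>
  (\<open>velocity_contracted_B_coeff\<close>). The Euler identity integrates to local homogeneity,
  \<open>\<alpha>\<^sub>\<nu>(q, c v, t) = c \<alpha>\<^sub>\<nu>(q, v, t)\<close> for \<open>c\<close> near \<open>1\<close>. Differentiating this first in \<open>q\<close>, \<open>t\<close> or \<open>v\<close>
  and then in \<open>c\<close> at \<open>c = 1\<close> shows that \<open>\<partial>\<alpha>\<^sub>\<nu>/\<partial>q\<^sub>j\<close> and \<open>\<partial>\<alpha>\<^sub>\<nu>/\<partial>t\<close> satisfy the Euler identity of degree
  one and \<open>\<partial>\<alpha>\<^sub>\<nu>/\<partial>v\<^sub>r\<close> that of degree zero (\<open>Euler_dir_deriv\<close>). In the contraction of \<open>B\<^sub>i\<^sup>\<nu>\<close> the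
  accelerations then disappear and the terms with \<open>\<partial>\<alpha>\<^sub>\<nu>/\<partial>q\<^sub>j\<close> cancel in pairs.

  The derivatives \<open>dP\<^sub>i/dt\<close> exist because \<open>T\<close> is quadratic in the velocities with coefficients built
  from the first derivatives of \<open>X\<close>, so that \<open>\<partial>T/\<partial>v\<^sub>j\<close> is as smooth as these.
\<close>

section \<open>Directional derivatives and total derivatives\<close>

lemma dir_deriv_eq:
  assumes "(f has_derivative f') (at x)"
  shows "dir_deriv e f x = f' e"
proof -
  have "((\<lambda>h. x + h *\<^sub>R e) has_derivative (\<lambda>h. h *\<^sub>R e)) (at (0::real))"
    by (auto intro!: derivative_eq_intros)
  moreover have "(f has_derivative f') (at (x + 0 *\<^sub>R e))"
    using assms by simp
  ultimately have "((\<lambda>h. f (x + h *\<^sub>R e)) has_derivative (\<lambda>h. f' (h *\<^sub>R e))) (at 0)"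
    by (rule has_derivative_compose)
  then have "((\<lambda>h. f (x + h *\<^sub>R e)) has_vector_derivative f' e) (at 0)"
    using linear_scale[OF has_derivative_linear[OF assms]] by (simp add: has_vector_derivative_def)
  then show ?thesis
    unfolding dir_deriv_def by (rule vector_derivative_at)
qed

lemma has_derivative_dir_deriv:
  assumes "f differentiable (at x)"
  shows "(f has_derivative (\<lambda>e. dir_deriv e f x)) (at x)"
proof -
  obtain f' where f': "(f has_derivative f') (at x)"
    using assms by (auto simp: differentiable_def)
  then have "(\<lambda>e. dir_deriv e f x) = f'"
    by (simp add: dir_deriv_eq fun_eq_iff)
  then show ?thesis using f' by simp
qed

lemma dir_deriv_compose:
  assumes "g differentiable (at x)" "f differentiable (at (g x))"
  shows "dir_deriv e (\<lambda>x. f (g x)) x = dir_deriv (dir_deriv e g x) f (g x)"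
  by (rule dir_deriv_eq)
     (rule has_derivative_compose[OF has_derivative_dir_deriv[OF assms(1)]
        has_derivative_dir_deriv[OF assms(2)]])

lemma dir_deriv_add:
  assumes "f differentiable (at x)" "g differentiable (at x)"
  shows "dir_deriv e (\<lambda>x. f x + g x) x = dir_deriv e f x + dir_deriv e g x"
  by (rule dir_deriv_eq) (intro has_derivative_add has_derivative_dir_deriv assms)

lemma dir_deriv_scaleR_direction:
  assumes "f differentiable (at x)"
  shows "dir_deriv (c *\<^sub>R e) f x = c *\<^sub>R dir_deriv e f x"
  using linear_scale[OF has_derivative_linear[OF has_derivative_dir_deriv[OF assms]]] .

text \<open>
  The chain rule behind every total derivative along the motion, and behind every derivative with
  respect to a scaling factor of the velocities.
\<close>

lemma dir_deriv_along_curve: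
  assumes "(\<gamma> has_vector_derivative \<gamma>') (at t)" "f differentiable (at (\<gamma> t))"
  shows "((\<lambda>\<tau>. f (\<gamma> \<tau>)) has_vector_derivative dir_deriv \<gamma>' f (\<gamma> t)) (at t)"
  using has_derivative_compose[OF assms(1)[unfolded has_vector_derivative_def]
      has_derivative_dir_deriv[OF assms(2)]]
  by (simp add: has_vector_derivative_def dir_deriv_scaleR_direction[OF assms(2)])

lemma differentiable_cong_open:
  assumes "f differentiable (at x)" "open S" "x \<in> S" "\<And>y. y \<in> S \<Longrightarrow> f y = g y"
  shows "g differentiable (at x)"
  using assms has_derivative_transform_within_open unfolding differentiable_def by blast

lemma differentiable_Pair:
  assumes "f differentiable (at x)" "g differentiable (at x)"
  shows "(\<lambda>x. (f x, g x)) differentiable (at x)"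
  using assms has_derivative_Pair unfolding differentiable_def by blast

lemma C1_on_differentiable:
  assumes "C1_on S f" "x \<in> S"
  shows "f differentiable (at x)"
  using assms unfolding C1_on_def differentiable_def by blast

lemma C2_on_differentiable:
  assumes "C2_on S f" "x \<in> S"
  shows "f differentiable (at x)"
  using assms unfolding C2_on_def differentiable_def by blast

lemma C2_on_dir_deriv_differentiable:
  assumes "C2_on S f" "open S" "x \<in> S"
  shows "dir_deriv e f differentiable (at x)"
proof -
  obtain f' where f': "\<And>y. y \<in> S \<Longrightarrow> (f has_derivative blinfun_apply (f' y)) (at y)" "C1_on S f'"
    using assms(1) unfolding C2_on_def by blast
  obtain f'' where f'': "(f' has_derivative f'') (at x)"
    using C1_on_differentiable[OF f'(2) assms(3)] by (auto simp: differentiable_def)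
  have "((\<lambda>y. blinfun_apply (f' y) e) has_derivative (\<lambda>h. blinfun_apply (f'' h) e)) (at x)"
    by (rule bounded_linear.has_derivative[OF blinfun.bounded_linear_left f''])
  then have "(\<lambda>y. blinfun_apply (f' y) e) differentiable (at x)"
    unfolding differentiable_def by blast
  then show ?thesis
    by (rule differentiable_cong_open[OF _ assms(2,3)]) (simp add: dir_deriv_eq[OF f'(1)])
qed

lemma sum_axis: "(\<Sum>i\<in>UNIV. x $ i *\<^sub>R axis i 1) = (x :: real^'n)"
  using basis_expansion[of x] by (simp add: scalar_mult_eq_scaleR)

text \<open>
  Joint differentiability makes the directional derivative linear in the direction; this is how
  total derivatives become sums of the partial derivatives named in the equations of motion.
\<close>

lemma dir_deriv_coordinates:
  fixes f :: "(real^'n) \<times> (real^'v) \<times> real \<Rightarrow> real"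
  assumes "f differentiable (at s)"
  shows "dir_deriv (a, b, c) f s
    = (\<Sum>j\<in>UNIV. a $ j * D_q j f s) + (\<Sum>i\<in>UNIV. b $ i * D_v i f s) + c * D_t f s"
proof -
  interpret linear "\<lambda>e. dir_deriv e f s"
    by (rule has_derivative_linear[OF has_derivative_dir_deriv[OF assms]])
  have "(a, b, c) = (\<Sum>j\<in>UNIV. a $ j *\<^sub>R (axis j 1, 0, 0))
      + (\<Sum>i\<in>UNIV. b $ i *\<^sub>R (0, axis i 1, 0)) + c *\<^sub>R (0, 0, 1)"
    by (simp add: prod_eq_iff fst_sum snd_sum sum_axis)
  then have "dir_deriv (a, b, c) f s = dir_deriv ((\<Sum>j\<in>UNIV. a $ j *\<^sub>R (axis j 1, 0, 0))
      + (\<Sum>i\<in>UNIV. b $ i *\<^sub>R (0, axis i 1, 0)) + c *\<^sub>R (0, 0, 1)) f s"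
    by simp
  then show ?thesis
    unfolding add sum scale by (simp add: D_q_def D_v_def D_t_def)
qed

section \<open>Homogeneity of degree one in the velocities\<close>

abbreviation scale_velocity :: "real \<Rightarrow> 'a \<times> 'b \<times> 'c \<Rightarrow> 'a \<times> 'b::real_vector \<times> 'c" where
  "scale_velocity c s \<equiv> (fst s, c *\<^sub>R fst (snd s), snd (snd s))"

text \<open>
  The converse half of Euler's theorem on homogeneous functions: by the identity, the quotient
  \<open>f(x, c v, t) / c\<close> has derivative zero in \<open>c\<close>. The argument needs the whole segment between
  \<open>(x, v, t)\<close> and \<open>(x, c v, t)\<close> inside \<open>S\<close>, so it only gives homogeneity for \<open>c\<close> near \<open>1\<close>;
  it must hold uniformly for \<open>y\<close> near \<open>s\<close>, since it will be differentiated in \<open>y\<close> for fixed \<open>c\<close>.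
\<close>

lemma Euler_imp_locally_homogeneous:
  fixes f :: "'a::real_normed_vector \<times> 'b::real_normed_vector \<times> 'c::real_normed_vector \<Rightarrow> real"
  assumes "open S" and diff: "\<And>s. s \<in> S \<Longrightarrow> f differentiable (at s)"
    and Euler: "\<And>x v t. (x, v, t) \<in> S \<Longrightarrow> dir_deriv (0, v, 0) f (x, v, t) = f (x, v, t)"
    and "s \<in> S"
  shows "\<forall>\<^sub>F c in nhds 1. \<forall>\<^sub>F y in nhds s. f (scale_velocity c y) = c * f y"
proof -
  let ?g = "\<lambda>p :: real \<times> 'a \<times> 'b \<times> 'c. scale_velocity (fst p) (snd p)"
  have "(?g \<longlongrightarrow> ?g (1, s)) (nhds (1, s))"
    by (intro tendsto_intros filterlim_ident)
  then have "\<forall>\<^sub>F p in nhds (1, s). ?g p \<in> S"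
    using \<open>open S\<close> \<open>s \<in> S\<close> by (auto dest: topological_tendstoD)
  then obtain P R where P: "eventually P (nhds (1::real))" and R: "eventually R (nhds s)"
    and PR: "\<And>c y. P c \<Longrightarrow> R y \<Longrightarrow> scale_velocity c y \<in> S"
    unfolding nhds_prod eventually_prod_filter by auto
  obtain d where "d > 0" and d: "\<And>c. dist c 1 < d \<Longrightarrow> P c"
    using P by (auto simp: eventually_nhds_metric)
  \<comment> \<open>An interval of admissible factors around \<open>1\<close>; the radius is at most \<open>1\<close> to keep it away from \<open>c = 0\<close>.\<close>
  define J where "J = {1 - min d 1 <..< 1 + min d 1}"
  have J: "open J" "convex J" "1 \<in> J" "\<And>c. c \<in> J \<Longrightarrow> c > 0" "\<And>c. c \<in> J \<Longrightarrow> P c"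
    using \<open>d > 0\<close> by (auto simp: J_def dist_real_def intro!: d)
  have *: "f (scale_velocity c y) = c * f y" if "c \<in> J" "R y" for c y
  proof -
    obtain x v t where y: "y = (x, v, t)"
      by (cases y)
    have der: "((\<lambda>c. f (x, c *\<^sub>R v, t) / c) has_field_derivative 0) (at c within J)"
      if "c \<in> J" for c
    proof -
      have S: "(x, c *\<^sub>R v, t) \<in> S"
        using PR[OF J(5)[OF that] \<open>R y\<close>] by (simp add: y)
      have curve: "((\<lambda>c. (x, c *\<^sub>R v, t)) has_vector_derivative (0, v, 0)) (at c)"
        unfolding has_vector_derivative_def
        by (auto intro!: derivative_eq_intros)
      have "c *\<^sub>R dir_deriv (0, v, 0) f (x, c *\<^sub>R v, t) = f (x, c *\<^sub>R v, t)"
        using Euler[OF S] dir_deriv_scaleR_direction[OF diff[OF S], of c "(0, v, 0)"] by simp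
      moreover have "c \<noteq> 0"
        using J(4)[OF that] by simp
      ultimately have "dir_deriv (0, v, 0) f (x, c *\<^sub>R v, t) = f (x, c *\<^sub>R v, t) / c"
        by (simp add: field_simps)
      then have "((\<lambda>c. f (x, c *\<^sub>R v, t)) has_field_derivative f (x, c *\<^sub>R v, t) / c) (at c)"
        using dir_deriv_along_curve[OF curve diff[OF S]]
        by (simp add: has_real_derivative_iff_has_vector_derivative)
      from DERIV_divide[OF this DERIV_ident \<open>c \<noteq> 0\<close>]
      have "((\<lambda>c. f (x, c *\<^sub>R v, t) / c) has_field_derivative 0) (at c)"
        using \<open>c \<noteq> 0\<close> by simp
      then show ?thesis
        by (rule has_field_derivative_at_within)
    qed
    have "f (x, c *\<^sub>R v, t) / c = f (x, 1 *\<^sub>R v, t) / 1"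
      using has_field_derivative_zero_constant[OF J(2) der] that(1) J(3) by metis
    then show ?thesis
      using J(4)[OF that(1)] by (simp add: y field_simps)
  qed
  have "\<forall>\<^sub>F c in nhds 1. c \<in> J"
    using J(1,3) by (rule eventually_nhds_in_open)
  then show ?thesis
    by (rule eventually_mono) (use R * in \<open>auto elim: eventually_mono\<close>)
qed

text \<open>
  Differentiating \<open>f(x, c v, t) = c f(x, v, t)\<close> in a direction that leaves \<open>v\<close> fixed shows that this
  derivative is again homogeneous of degree one; in a velocity direction a factor \<open>c\<close> cancels and
  the degree drops to zero. Both conclusions are the derivatives of these relations in \<open>c\<close> at \<open>1\<close>,
  so the mixed derivatives come out in the order in which they occur in \<open>B\<^sub>i\<^sup>\<nu>\<close>: velocity last.
\<close>

lemma Euler_dir_deriv: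
  fixes f :: "'a::real_normed_vector \<times> 'b::real_normed_vector \<times> 'c::real_normed_vector \<Rightarrow> real"
  assumes "open S" and diff: "\<And>s. s \<in> S \<Longrightarrow> f differentiable (at s)"
    and Euler: "\<And>x v t. (x, v, t) \<in> S \<Longrightarrow> dir_deriv (0, v, 0) f (x, v, t) = f (x, v, t)"
    and mem: "(x, v, t) \<in> S"
  shows "dir_deriv (a, 0, c) f differentiable (at (x, v, t)) \<Longrightarrow>
           dir_deriv (0, v, 0) (dir_deriv (a, 0, c) f) (x, v, t) = dir_deriv (a, 0, c) f (x, v, t)"
    and "dir_deriv (0, b, 0) f differentiable (at (x, v, t)) \<Longrightarrow>
           dir_deriv (0, v, 0) (dir_deriv (0, b, 0) f) (x, v, t) = 0"
proof -
  have S: "\<forall>\<^sub>F h in nhds 1. (x, h *\<^sub>R v, t) \<in> S"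
  proof -
    have "((\<lambda>h. (x, h *\<^sub>R v, t)) \<longlongrightarrow> (x, 1 *\<^sub>R v, t)) (nhds 1)"
      by (intro tendsto_intros filterlim_ident)
    then show ?thesis
      using \<open>open S\<close> mem by (auto dest: topological_tendstoD)
  qed
  have "\<forall>\<^sub>F h in nhds 1. \<forall>\<^sub>F y in nhds (x, v, t). f (scale_velocity h y) = h * f y"
    by (rule Euler_imp_locally_homogeneous[OF assms(1) diff Euler mem])
  with S have scaled: "\<forall>\<^sub>F h in nhds 1. \<forall>a b c. dir_deriv (a, h *\<^sub>R b, c) f (x, h *\<^sub>R v, t)
                                = h * dir_deriv (a, b, c) f (x, v, t)"
  proof eventually_elim
    case (elim h)
    have "(f has_derivative (\<lambda>e. dir_deriv e f (x, h *\<^sub>R v, t)))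
        (at (scale_velocity h (x, v, t)))"
      using has_derivative_dir_deriv[OF diff[OF elim(1)]] by simp
    moreover have "(scale_velocity h has_derivative scale_velocity h) (at (x, v, t))"
      by (auto intro!: derivative_eq_intros)
    ultimately have "((\<lambda>y. f (scale_velocity h y)) has_derivative
        (\<lambda>e. dir_deriv (scale_velocity h e) f (x, h *\<^sub>R v, t))) (at (x, v, t))"
      by (rule has_derivative_compose[rotated])
    moreover have "((\<lambda>y. h * f y) has_derivative (\<lambda>e. h * dir_deriv e f (x, v, t))) (at (x, v, t))"
      by (intro has_derivative_mult_right has_derivative_dir_deriv diff mem)
    moreover obtain N where "open N" "(x, v, t) \<in> N"
        "\<And>y. y \<in> N \<Longrightarrow> f (scale_velocity h y) = h * f y"
      using elim(2) unfolding eventually_nhds by blast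
    ultimately have "(\<lambda>e. dir_deriv (scale_velocity h e) f (x, h *\<^sub>R v, t))
        = (\<lambda>e. h * dir_deriv e f (x, v, t))"
      by (meson has_derivative_transform_within_open has_derivative_unique)
    then show ?case
      by (auto simp: fun_eq_iff)
  qed
  have curve: "((\<lambda>h. (x, h *\<^sub>R v, t)) has_vector_derivative (0, v, 0)) (at 1)"
    unfolding has_vector_derivative_def by (auto intro!: derivative_eq_intros)
  have along: "((\<lambda>h. g (x, h *\<^sub>R v, t)) has_real_derivative dir_deriv (0, v, 0) g (x, v, t)) (at 1)"
    if "g differentiable (at (x, v, t))" for g :: "'a \<times> 'b \<times> 'c \<Rightarrow> real"
    using dir_deriv_along_curve[OF curve, of g] that
    by (simp add: has_real_derivative_iff_has_vector_derivative)
  show "dir_deriv (0, v, 0) (dir_deriv (a, 0, c) f) (x, v, t) = dir_deriv (a, 0, c) f (x, v, t)"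
    if "dir_deriv (a, 0, c) f differentiable (at (x, v, t))"
  proof -
    have "\<forall>\<^sub>F h in nhds 1. dir_deriv (a, 0, c) f (x, h *\<^sub>R v, t) = h * dir_deriv (a, 0, c) f (x, v, t)"
      using scaled by (rule eventually_mono) (metis scaleR_zero_right)
    moreover have "((\<lambda>h. h * dir_deriv (a, 0, c) f (x, v, t)) has_real_derivative
        dir_deriv (a, 0, c) f (x, v, t)) (at 1)"
      by (auto intro!: derivative_eq_intros)
    ultimately have "((\<lambda>h. dir_deriv (a, 0, c) f (x, h *\<^sub>R v, t)) has_real_derivative
        dir_deriv (a, 0, c) f (x, v, t)) (at 1)"
      by (subst DERIV_cong_ev) auto
    then show ?thesis
      using along[OF that] DERIV_unique by blast
  qed
  show "dir_deriv (0, v, 0) (dir_deriv (0, b, 0) f) (x, v, t) = 0"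
    if "dir_deriv (0, b, 0) f differentiable (at (x, v, t))"
  proof -
    \<comment> \<open>Needed to cancel the factor \<open>h\<close> that the scaled direction \<open>h *\<^sub>R b\<close> contributes on both sides.\<close>
    have "\<forall>\<^sub>F h in nhds (1::real). h \<noteq> 0"
      by (rule t1_space_nhds) simp
    with scaled S have "\<forall>\<^sub>F h in nhds 1. dir_deriv (0, b, 0) f (x, h *\<^sub>R v, t)
        = dir_deriv (0, b, 0) f (x, v, t)"
    proof eventually_elim
      case (elim h)
      have "h * dir_deriv (0, b, 0) f (x, h *\<^sub>R v, t) = dir_deriv (0, h *\<^sub>R b, 0) f (x, h *\<^sub>R v, t)"
        using dir_deriv_scaleR_direction[OF diff[OF elim(2)], of h "(0, b, 0)"] by simp
      then show ?case
        using elim(1,3) by simp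
    qed
    then have "((\<lambda>h. dir_deriv (0, b, 0) f (x, h *\<^sub>R v, t)) has_real_derivative 0) (at 1)"
      by (subst DERIV_cong_ev[where g = "\<lambda>_. dir_deriv (0, b, 0) f (x, v, t)"]) auto
    then show ?thesis
      using along[OF that] DERIV_unique by blast
  qed
qed

text \<open>
  Contracting \<open>B\<^sub>i\<^sup>\<nu>\<close> with \<open>v\<^sub>i\<close> evaluates all its second derivatives by the Euler identities. The
  first sum becomes \<open>\<Sum>\<^sub>r v\<^sub>r \<partial>\<alpha>\<^sub>\<nu>/\<partial>q\<^sub>r\<close>, which cancels against the term \<open>- \<partial>\<alpha>\<^sub>\<nu>/\<partial>q\<^sub>i\<close>; the two parts of
  the sum over \<open>\<mu>\<close> become equal; only the last term survives.
\<close>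

lemma velocity_contracted_B_coeff:
  fixes \<alpha> :: "'k::finite \<Rightarrow> ('m::finite, 'k) state \<Rightarrow> real"
  assumes "open \<Omega>" "C2_on \<Omega> (\<alpha> \<nu>)"
    and homogeneous: "\<And>x v t. (x, v, t) \<in> \<Omega> \<Longrightarrow>
      (\<Sum>i\<in>UNIV. v $ i * D_v i (\<alpha> \<nu>) (x, v, t)) = \<alpha> \<nu> (x, v, t)"
    and homogeneous': "\<And>\<mu>. (\<Sum>i\<in>UNIV. v $ i * D_v i (\<alpha> \<mu>) (x, v, t)) = \<alpha> \<mu> (x, v, t)"
    and mem: "(x, v, t) \<in> \<Omega>"
  shows "(\<Sum>i\<in>UNIV. v $ i * B_coeff \<alpha> i \<nu> (x, v, t) a) = D_t (\<alpha> \<nu>) (x, v, t)"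
proof -
  let ?s = "(x, v, t)" and ?f = "\<alpha> \<nu>"
  have diff: "?f differentiable (at s)" if "s \<in> \<Omega>" for s
    using C2_on_differentiable[OF assms(2) that] .
  have ddiff: "dir_deriv e ?f differentiable (at ?s)" for e
    using C2_on_dir_deriv_differentiable[OF assms(2,1) mem] .
  have contract: "(\<Sum>i\<in>UNIV. v $ i * D_v i g (x, v, t)) = dir_deriv (0, v, 0) g (x, v, t)"
    if "g differentiable (at (x, v, t))" for x v t and g :: "('m, 'k) state \<Rightarrow> real"
    using dir_deriv_coordinates[OF that, of 0 v 0] by simp
  have Euler: "dir_deriv (0, v, 0) ?f (x, v, t) = ?f (x, v, t)" if "(x, v, t) \<in> \<Omega>" for x v t
    using homogeneous[OF that] contract[OF diff[OF that]] by simp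
  note Euler' = Euler_dir_deriv[OF assms(1) diff Euler mem]
  have q: "(\<Sum>i\<in>UNIV. v $ i * D_v i (D_q j ?f) ?s) = D_q j ?f ?s" for j
    using Euler'(1)[OF _ _ ddiff] contract[OF ddiff] by (simp add: D_q_def)
  have t: "(\<Sum>i\<in>UNIV. v $ i * D_v i (D_t ?f) ?s) = D_t ?f ?s"
    using Euler'(1)[OF _ _ ddiff] contract[OF ddiff] by (simp add: D_t_def)
  have v: "(\<Sum>i\<in>UNIV. v $ i * D_v i (D_v r ?f) ?s) = 0" for r
    using Euler'(2)[OF _ _ ddiff] contract[OF ddiff] unfolding D_v_def[of r] by simp
  have 1: "(\<Sum>i\<in>UNIV. v $ i * (\<Sum>r\<in>UNIV. D_v i (D_q (Inl r) ?f) ?s * v $ r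
               + D_v i (D_v r ?f) ?s * a $ r)) = (\<Sum>r\<in>UNIV. D_q (Inl r) ?f ?s * v $ r)"
  proof -
    have "(\<Sum>i\<in>UNIV. v $ i * (\<Sum>r\<in>UNIV. D_v i (D_q (Inl r) ?f) ?s * v $ r + D_v i (D_v r ?f) ?s * a $ r))
      = (\<Sum>r\<in>UNIV. \<Sum>i\<in>UNIV. v $ i * (D_v i (D_q (Inl r) ?f) ?s * v $ r + D_v i (D_v r ?f) ?s * a $ r))"
      unfolding sum_distrib_left by (rule sum.swap)
    also have "\<dots> = (\<Sum>r\<in>UNIV. (\<Sum>i\<in>UNIV. v $ i * D_v i (D_q (Inl r) ?f) ?s) * v $ r
        + (\<Sum>i\<in>UNIV. v $ i * D_v i (D_v r ?f) ?s) * a $ r)"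
      by (simp add: algebra_simps sum.distrib sum_distrib_left)
    finally show ?thesis by (simp add: q v)
  qed
  have 2: "(\<Sum>i\<in>UNIV. v $ i * (\<Sum>\<mu>\<in>UNIV. D_v i (D_q (Inr \<mu>) ?f) ?s * \<alpha> \<mu> ?s
               - D_v i (\<alpha> \<mu>) ?s * D_q (Inr \<mu>) ?f ?s)) = 0"
  proof -
    have "(\<Sum>i\<in>UNIV. v $ i * (\<Sum>\<mu>\<in>UNIV. D_v i (D_q (Inr \<mu>) ?f) ?s * \<alpha> \<mu> ?s
               - D_v i (\<alpha> \<mu>) ?s * D_q (Inr \<mu>) ?f ?s))
      = (\<Sum>\<mu>\<in>UNIV. \<Sum>i\<in>UNIV. v $ i * (D_v i (D_q (Inr \<mu>) ?f) ?s * \<alpha> \<mu> ?s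
               - D_v i (\<alpha> \<mu>) ?s * D_q (Inr \<mu>) ?f ?s))"
      unfolding sum_distrib_left by (rule sum.swap)
    also have "\<dots> = (\<Sum>\<mu>\<in>UNIV. (\<Sum>i\<in>UNIV. v $ i * D_v i (D_q (Inr \<mu>) ?f) ?s) * \<alpha> \<mu> ?s
        - (\<Sum>i\<in>UNIV. v $ i * D_v i (\<alpha> \<mu>) ?s) * D_q (Inr \<mu>) ?f ?s)"
      by (simp add: algebra_simps sum_subtractf sum_distrib_left)
    finally show ?thesis by (simp add: q homogeneous')
  qed
  have "(\<Sum>i\<in>UNIV. v $ i * B_coeff \<alpha> i \<nu> ?s a)
    = (\<Sum>r\<in>UNIV. D_q (Inl r) ?f ?s * v $ r) - (\<Sum>i\<in>UNIV. v $ i * D_q (Inl i) ?f ?s) + D_t ?f ?s"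
    using 1 2 t by (simp add: B_coeff_def distrib_left right_diff_distrib sum.distrib sum_subtractf)
  then show ?thesis by (simp add: mult.commute)
qed

section \<open>The kinetic energy\<close>

lemma bounded_linear_mass_scaled: "bounded_linear (mass_scaled M)"
  unfolding linear_conv_bounded_linear[symmetric]
  by (rule linearI) (auto simp: mass_scaled_def vec_eq_iff algebra_simps)

lemma mass_scaled_inner_commute: "mass_scaled M x \<bullet> y = x \<bullet> mass_scaled M y"
  by (simp add: mass_scaled_def inner_vec_def mult_ac)

lemma velocity_mass_scaled:
  fixes X :: "(real^'n) \<times> real \<Rightarrow> ('p::finite) config"
  assumes "X differentiable (at (x, t))"
  shows "velocity (mass_scaled M \<circ> X) (x, v, t) = mass_scaled M (velocity X (x, v, t))"
proof -
  interpret m: bounded_linear "mass_scaled M"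
    by (rule bounded_linear_mass_scaled)
  have "dir_deriv e (mass_scaled M \<circ> X) (x, t) = mass_scaled M (dir_deriv e X (x, t))" for e
    unfolding o_def
    by (rule dir_deriv_eq) (rule m.has_derivative[OF has_derivative_dir_deriv[OF assms]])
  then show ?thesis
    by (simp add: velocity_def pd_q_def pd_t_def m.add m.sum m.scaleR)
qed

text \<open>
  \<open>X\<close> is smooth on \<open>Q\<close> only, while the velocities of a state are unrestricted. The lemmas below
  therefore speak of the open set of all states whose coordinates and time lie in \<open>Q\<close>.
\<close>

context
  fixes X :: "(real^'n) \<times> real \<Rightarrow> ('p::finite) config" and Q
  assumes Q: "open Q" and X: "C2_on Q X"
begin

lemma open_base: "open {s :: (real^'n) \<times> (real^'v) \<times> real. (fst s, snd (snd s)) \<in> Q}"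
  by (rule continuous_open_preimage[OF _ open_UNIV Q, of "\<lambda>s. (fst s, snd (snd s))", simplified vimage_def, simplified])
     (intro continuous_intros)

lemma dir_deriv_base_differentiable:
  fixes s :: "(real^'n) \<times> (real^'v) \<times> real"
  assumes "(fst s, snd (snd s)) \<in> Q"
  shows "(\<lambda>s. dir_deriv e X (fst s, snd (snd s))) differentiable (at s)"
proof -
  have "(\<lambda>s::(real^'n) \<times> (real^'v) \<times> real. (fst s, snd (snd s))) differentiable (at s)"
    unfolding differentiable_def by (rule exI) (auto intro!: derivative_eq_intros)
  then show ?thesis
    using C2_on_dir_deriv_differentiable[OF X Q assms]
    by (rule differentiable_compose[rotated, unfolded o_def])
qed

lemma velocity_differentiable:
  assumes "(fst s, snd (snd s)) \<in> Q"
  shows "velocity X differentiable (at s)"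
proof -
  have "velocity X = (\<lambda>s. (\<Sum>j\<in>UNIV. (fst (snd s)) $ j *\<^sub>R dir_deriv (axis j 1, 0) X (fst s, snd (snd s)))
      + dir_deriv (0, 1) X (fst s, snd (snd s)))"
    by (auto simp: velocity_def pd_q_def pd_t_def fun_eq_iff)
  moreover have "(\<lambda>s::(real^'n) \<times> (real^'n) \<times> real. fst (snd s) $ j) differentiable (at s)" for j
  proof -
    have "((\<lambda>s::(real^'n) \<times> (real^'n) \<times> real. fst (snd s)) has_derivative (\<lambda>e. fst (snd e))) (at s)"
      by (auto intro!: derivative_eq_intros)
    from bounded_linear.has_derivative[OF bounded_linear_vec_nth this] show ?thesis
      unfolding differentiable_def by blast
  qed
  ultimately show ?thesis
    using dir_deriv_base_differentiable[OF assms]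
    by (auto intro!: differentiable_add differentiable_sum differentiable_scaleR)
qed

lemma kinetic_energy_eq:
  assumes "(fst s, snd (snd s)) \<in> Q"
  shows "kinetic_energy M X s = 1/2 * (mass_scaled M (velocity X s) \<bullet> velocity X s)"
  using velocity_mass_scaled[OF C2_on_differentiable[OF X assms], of M "fst (snd s)"]
  by (simp add: kinetic_energy_def)

lemma mass_velocity_differentiable:
  assumes "(fst s, snd (snd s)) \<in> Q"
  shows "(\<lambda>s. mass_scaled M (velocity X s)) differentiable (at s)"
  using velocity_differentiable[OF assms] bounded_linear.has_derivative[OF bounded_linear_mass_scaled]
  unfolding differentiable_def by blast

lemma kinetic_energy_differentiable:
  assumes "(fst s, snd (snd s)) \<in> Q"
  shows "kinetic_energy M X differentiable (at s)"
proof -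
  have "(\<lambda>s. 1/2 * (mass_scaled M (velocity X s) \<bullet> velocity X s)) differentiable (at s)"
    using assms
    by (intro differentiable_mult differentiable_inner differentiable_const
        mass_velocity_differentiable velocity_differentiable)
  then show ?thesis
    by (rule differentiable_cong_open[OF _ open_base]) (use assms in \<open>auto simp: kinetic_energy_eq\<close>)
qed

text \<open>
  The velocity of the points is affine in the generalized velocities, and the mass-weighted inner
  product is symmetric, so the two halves of the derivative of the quadratic form agree and absorb
  the factor \<open>1/2\<close>. The right-hand side is visibly differentiable in all arguments.
\<close>

lemma velocity_momentum:
  assumes "(fst s, snd (snd s)) \<in> Q"
  shows "D_v j (kinetic_energy M X) s
    = mass_scaled M (velocity X s) \<bullet> dir_deriv (axis j 1, 0) X (fst s, snd (snd s))"
proof -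
  let ?P = "dir_deriv (axis j 1, 0) X (fst s, snd (snd s))" and ?V = "velocity X s"
  have V: "velocity X (s + h *\<^sub>R (0, axis j 1, 0)) = ?V + h *\<^sub>R ?P" for h
  proof -
    have "axis j 1 $ i *\<^sub>R pd_q i X b = (if i = j then pd_q i X b else 0)" for i b
      by (simp add: axis_def)
    then have "(\<Sum>i\<in>UNIV. axis j 1 $ i *\<^sub>R pd_q i X b) = dir_deriv (axis j 1, 0) X b" for b
      by (simp add: pd_q_def)
    then show ?thesis
      by (simp add: velocity_def split_beta scaleR_add_left sum.distrib
          scaleR_scaleR[symmetric] scaleR_sum_right[symmetric] del: scaleR_scaleR)
  qed
  have "D_v j (kinetic_energy M X) s = vector_derivative
      (\<lambda>h. 1/2 * (mass_scaled M (?V + h *\<^sub>R ?P) \<bullet> (?V + h *\<^sub>R ?P))) (at 0)"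
  proof -
    have "kinetic_energy M X (s + h *\<^sub>R (0, axis j 1, 0))
        = 1/2 * (mass_scaled M (?V + h *\<^sub>R ?P) \<bullet> (?V + h *\<^sub>R ?P))" for h
      using kinetic_energy_eq[of "s + h *\<^sub>R (0, axis j 1, 0)"] assms unfolding V by simp
    then show ?thesis
      by (simp only: D_v_def dir_deriv_def)
  qed
  also have "\<dots> = mass_scaled M ?V \<bullet> ?P"
  proof (rule vector_derivative_at)
    interpret m: bounded_linear "mass_scaled M"
      by (rule bounded_linear_mass_scaled)
    have "((\<lambda>h. mass_scaled M (?V + h *\<^sub>R ?P)) has_derivative (\<lambda>h. mass_scaled M (h *\<^sub>R ?P))) (at 0)"
      by (rule m.has_derivative) (auto intro!: derivative_eq_intros)
    then show "((\<lambda>h. 1/2 * (mass_scaled M (?V + h *\<^sub>R ?P) \<bullet> (?V + h *\<^sub>R ?P)))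
        has_vector_derivative mass_scaled M ?V \<bullet> ?P) (at 0)"
      unfolding has_vector_derivative_def
      by (auto intro!: derivative_eq_intros
          simp: fun_eq_iff m.scaleR mass_scaled_inner_commute[of M ?V] inner_commute algebra_simps)
  qed
  finally show ?thesis .
qed

lemma velocity_momentum_differentiable:
  assumes "(fst s, snd (snd s)) \<in> Q"
  shows "D_v j (kinetic_energy M X) differentiable (at s)"
proof -
  have "(\<lambda>s. mass_scaled M (velocity X s) \<bullet> dir_deriv (axis j 1, 0) X (fst s, snd (snd s)))
      differentiable (at s)"
    using assms by (intro differentiable_inner mass_velocity_differentiable dir_deriv_base_differentiable)
  then show ?thesis
    by (rule differentiable_cong_open[OF _ open_base]) (use assms in \<open>auto simp: velocity_momentum\<close>)
qed

end

section \<open>The restricted kinetic energy and the potential\<close>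

lemma has_derivative_constrained:
  fixes \<alpha> :: "'k::finite \<Rightarrow> ('m::finite, 'k) state \<Rightarrow> real"
  assumes "\<And>\<nu>. \<alpha> \<nu> differentiable (at s)"
  shows "(constrained \<alpha> has_derivative (\<lambda>e. (fst e,
      \<chi> j. case j of Inl i \<Rightarrow> fst (snd e) $ i | Inr \<nu> \<Rightarrow> dir_deriv e (\<alpha> \<nu>) s, snd (snd e)))) (at s)"
proof -
  have c: "constrained \<alpha> = (\<lambda>s. (fst s,
      \<chi> j. case j of Inl i \<Rightarrow> fst (snd s) $ i | Inr \<nu> \<Rightarrow> \<alpha> \<nu> s, snd (snd s)))"
    by (auto simp: constrained_def fun_eq_iff)
  have "((\<lambda>s. \<chi> j. case j of Inl i \<Rightarrow> fst (snd s) $ i | Inr \<nu> \<Rightarrow> \<alpha> \<nu> s) has_derivative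
      (\<lambda>e. \<chi> j. case j of Inl i \<Rightarrow> fst (snd e) $ i | Inr \<nu> \<Rightarrow> dir_deriv e (\<alpha> \<nu>) s)) (at s)"
  proof (subst has_derivative_componentwise_within, intro ballI)
    fix b :: "real^('m + 'k)" assume "b \<in> Basis"
    then obtain j where b: "b = axis j 1"
      by (auto simp: Basis_vec_def)
    show "((\<lambda>s. (\<chi> j. case j of Inl i \<Rightarrow> fst (snd s) $ i | Inr \<nu> \<Rightarrow> \<alpha> \<nu> s) \<bullet> b) has_derivative
      (\<lambda>e. (\<chi> j. case j of Inl i \<Rightarrow> fst (snd e) $ i | Inr \<nu> \<Rightarrow> dir_deriv e (\<alpha> \<nu>) s) \<bullet> b)) (at s)"
    proof (cases j)
      case (Inl i)
      have "((\<lambda>s :: ('m, 'k) state. fst (snd s)) has_derivative (\<lambda>e. fst (snd e))) (at s)"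
        by (auto intro!: derivative_eq_intros)
      from bounded_linear.has_derivative[OF bounded_linear_vec_nth this] show ?thesis
        by (simp add: b inner_axis Inl)
    qed (simp add: b inner_axis has_derivative_dir_deriv[OF assms])
  qed
  then show ?thesis
    unfolding c by (auto intro!: derivative_eq_intros)
qed

lemma base_constrained: "(fst (constrained \<alpha> s), snd (snd (constrained \<alpha> s))) = (fst s, snd (snd s))"
  by (simp add: constrained_def split_beta)

lemma restricted_kinetic_energy_differentiable:
  fixes \<alpha> :: "'k::finite \<Rightarrow> ('m::finite, 'k) state \<Rightarrow> real"
  assumes "open Q" "C2_on Q X" "(fst s, snd (snd s)) \<in> Q"
    and "\<And>\<nu>. \<alpha> \<nu> differentiable (at s)"
  shows "restricted_kinetic_energy M X \<alpha> differentiable (at s)"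
proof -
  have "constrained \<alpha> differentiable (at s)"
    using has_derivative_constrained[of \<alpha>, OF assms(4)] by (auto simp: differentiable_def)
  moreover have "kinetic_energy M X differentiable (at (constrained \<alpha> s))"
    using assms by (intro kinetic_energy_differentiable) (simp_all add: base_constrained)
  ultimately have "kinetic_energy M X \<circ> constrained \<alpha> differentiable (at s)"
    by (rule differentiable_chain_at)
  then show ?thesis
    by (simp add: restricted_kinetic_energy_def[abs_def] o_def)
qed

lemma sum_over_sum_type:
  fixes g :: "'m::finite + 'k::finite \<Rightarrow> 'a::comm_monoid_add"
  shows "(\<Sum>j\<in>UNIV. g j) = (\<Sum>i\<in>UNIV. g (Inl i)) + (\<Sum>\<nu>\<in>UNIV. g (Inr \<nu>))"
  unfolding UNIV_Plus_UNIV[symmetric] by (subst sum.Plus) (simp_all add: o_def)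

text \<open>
  Varying an independent velocity \<open>v\<^sub>i\<close> also moves the dependent velocities through the constraints.
  The formula expresses the restricted momentum by momenta of the unrestricted \<open>T\<close> and first
  derivatives of the \<open>\<alpha>\<^sub>\<nu>\<close>, each of which can be differentiated once more.
\<close>

lemma restricted_momentum:
  fixes \<alpha> :: "'k::finite \<Rightarrow> ('m::finite, 'k) state \<Rightarrow> real"
  assumes "open Q" "C2_on Q X" "(fst s, snd (snd s)) \<in> Q"
    and "\<And>\<nu>. \<alpha> \<nu> differentiable (at s)"
  shows "D_v i (restricted_kinetic_energy M X \<alpha>) s
    = D_v (Inl i) (kinetic_energy M X) (constrained \<alpha> s)
      + (\<Sum>\<nu>\<in>UNIV. D_v i (\<alpha> \<nu>) s * D_v (Inr \<nu>) (kinetic_energy M X) (constrained \<alpha> s))"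
proof -
  let ?T = "kinetic_energy M X"
  have T: "?T differentiable (at (constrained \<alpha> s))"
    using assms by (intro kinetic_energy_differentiable) (simp_all add: base_constrained)
  have c: "constrained \<alpha> differentiable (at s)"
    using has_derivative_constrained[of \<alpha>, OF assms(4)] by (auto simp: differentiable_def)
  have "D_v i (restricted_kinetic_energy M X \<alpha>) s
    = dir_deriv (0, \<chi> j. case j of Inl l \<Rightarrow> axis i 1 $ l | Inr \<nu> \<Rightarrow> D_v i (\<alpha> \<nu>) s, 0) ?T (constrained \<alpha> s)"
    using dir_deriv_compose[OF c T, of "(0, axis i 1, 0)"]
    by (simp add: restricted_kinetic_energy_def[abs_def] D_v_def cong: sum.case_cong
        add: dir_deriv_eq[OF has_derivative_constrained[of \<alpha>, OF assms(4)]])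
  also have "\<dots> = D_v (Inl i) ?T (constrained \<alpha> s)
      + (\<Sum>\<nu>\<in>UNIV. D_v i (\<alpha> \<nu>) s * D_v (Inr \<nu>) ?T (constrained \<alpha> s))"
    by (simp add: dir_deriv_coordinates[OF T] sum_over_sum_type axis_def if_distrib[of "\<lambda>c. c * _"] cong: if_cong)
  finally show ?thesis .
qed

lemma restricted_momentum_differentiable:
  fixes \<alpha> :: "'k::finite \<Rightarrow> ('m::finite, 'k) state \<Rightarrow> real"
  assumes "open Q" "C2_on Q X" "open \<Omega>" "\<And>\<nu>. C2_on \<Omega> (\<alpha> \<nu>)"
    and \<Omega>: "\<And>s. s \<in> \<Omega> \<Longrightarrow> (fst s, snd (snd s)) \<in> Q" and "s \<in> \<Omega>"
  shows "D_v i (restricted_kinetic_energy M X \<alpha>) differentiable (at s)"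
proof -
  let ?T = "kinetic_energy M X"
  have diff: "\<alpha> \<nu> differentiable (at s)" if "s \<in> \<Omega>" for \<nu> s
    using C2_on_differentiable[OF assms(4) that] .
  have "constrained \<alpha> differentiable (at s)"
    using has_derivative_constrained[of \<alpha>, OF diff[OF \<open>s \<in> \<Omega>\<close>]] by (auto simp: differentiable_def)
  moreover have "D_v j ?T differentiable (at (constrained \<alpha> s))" for j
    using assms by (intro velocity_momentum_differentiable) (simp_all add: base_constrained)
  ultimately have T: "(\<lambda>s. D_v j ?T (constrained \<alpha> s)) differentiable (at s)" for j
    using differentiable_chain_at[of "constrained \<alpha>" s "D_v j ?T"] by (simp add: o_def)
  have \<alpha>: "D_v i (\<alpha> \<nu>) differentiable (at s)" for \<nu>
    unfolding D_v_def by (rule C2_on_dir_deriv_differentiable[OF assms(4,3,6)])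
  have "(\<lambda>s. D_v (Inl i) ?T (constrained \<alpha> s)
      + (\<Sum>\<nu>\<in>UNIV. D_v i (\<alpha> \<nu>) s * D_v (Inr \<nu>) ?T (constrained \<alpha> s))) differentiable (at s)"
    by (intro differentiable_add differentiable_sum differentiable_mult T \<alpha> finite ballI)
  then show ?thesis
    by (rule differentiable_cong_open[OF _ assms(3,6)])
       (simp add: restricted_momentum[OF assms(1,2) \<Omega> diff])
qed

abbreviation potential_on_states ::
    "((real^'n::finite) \<times> real \<Rightarrow> ('p::finite) config) \<Rightarrow> ('p config \<times> real \<Rightarrow> real)
      \<Rightarrow> (real^'n) \<times> (real^'v) \<times> real \<Rightarrow> real" where
  "potential_on_states X \<U> \<equiv> \<lambda>s. \<U> (X (fst s, snd (snd s)), snd (snd s))"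

lemma potential_differentiable:
  fixes s :: "(real^'n::finite) \<times> (real^'v) \<times> real"
  assumes "X differentiable (at (fst s, snd (snd s)))"
    and "\<U> differentiable (at (X (fst s, snd (snd s)), snd (snd s)))"
  shows "potential_on_states X \<U> differentiable (at s)"
proof -
  have b: "(\<lambda>s::(real^'n) \<times> (real^'v) \<times> real. (fst s, snd (snd s))) differentiable (at s)"
    and t: "(\<lambda>s::(real^'n) \<times> (real^'v) \<times> real. snd (snd s)) differentiable (at s)"
    unfolding differentiable_def by (rule exI, auto intro!: derivative_eq_intros)+
  have "(\<lambda>s::(real^'n) \<times> (real^'v) \<times> real. X (fst s, snd (snd s))) differentiable (at s)"
    using differentiable_chain_at[OF b assms(1)] by (simp add: o_def)
  from differentiable_chain_at[OF differentiable_Pair[OF this t] assms(2)]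
  show ?thesis
    by (simp add: o_def)
qed

lemma D_v_potential: "D_v i (potential_on_states X \<U>) s = 0"
  by (simp add: D_v_def dir_deriv_def)

lemma D_q_potential:
  assumes "X differentiable (at (x, t))" "GDERIV (\<lambda>y. \<U> (y, t)) (X (x, t)) :> F (X (x, t), t)"
  shows "D_q j (potential_on_states X \<U>) (x, v, t) = gen_force F X j (x, t)"
proof -
  have line: "((\<lambda>h. (x, t) + h *\<^sub>R (axis j 1, 0)) has_vector_derivative (axis j 1, 0)) (at (0::real))"
    unfolding has_vector_derivative_def by (auto intro!: derivative_eq_intros)
  have "((\<lambda>h. X ((x, t) + h *\<^sub>R (axis j 1, 0))) has_derivative (\<lambda>h. h *\<^sub>R pd_q j X (x, t))) (at 0)"
    using dir_deriv_along_curve[OF line, of X] assms(1)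
    by (simp add: pd_q_def has_vector_derivative_def zero_prod_def[symmetric])
  moreover have "((\<lambda>y. \<U> (y, t)) has_derivative (\<lambda>h. h \<bullet> F (X (x, t), t)))
      (at (X ((x, t) + 0 *\<^sub>R (axis j 1, 0))))"
    using assms(2) by (simp add: gderiv_def zero_prod_def[symmetric])
  ultimately have "((\<lambda>h. \<U> (X ((x, t) + h *\<^sub>R (axis j 1, 0)), t)) has_derivative
      (\<lambda>h. (h *\<^sub>R pd_q j X (x, t)) \<bullet> F (X (x, t), t))) (at 0)"
    by (rule has_derivative_compose)
  then have "((\<lambda>h. \<U> (X ((x, t) + h *\<^sub>R (axis j 1, 0)), t)) has_vector_derivative
      gen_force F X j (x, t)) (at 0)"
    by (simp add: has_vector_derivative_def gen_force_def inner_commute)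
  then show ?thesis
    unfolding D_q_def dir_deriv_def by (intro vector_derivative_at) simp
qed

section \<open>The energy balance\<close>

text \<open>
  The equations of motion at one instant, multiplied by \<open>v i\<close> and summed. Here \<open>P'\<close> stands for
  \<open>dP\<^sub>i/dt\<close>, \<open>Tl\<close> and \<open>Tr\<close> for the derivatives of \<open>T\<^sup>*\<close> by the independent and dependent coordinates,
  \<open>Fl\<close> and \<open>Fr\<close> for the corresponding generalized forces, \<open>A\<close> for \<open>\<partial>\<alpha>\<^sub>\<nu>/\<partial>v\<^sub>i\<close> and \<open>p\<close> for \<open>\<partial>T/\<partial>v\<^sub>m\<^sub>+\<^sub>\<nu>\<close>.
\<close>

lemma power_balance:
  fixes v P' :: "'m::finite \<Rightarrow> real" and \<alpha>' p :: "'k::finite \<Rightarrow> real"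
  assumes eqs: "\<And>i. P' i - Tl i - (\<Sum>\<nu>\<in>UNIV. Tr \<nu> * A i \<nu>) - (\<Sum>\<nu>\<in>UNIV. B i \<nu> * p \<nu>)
      = Fl i + (\<Sum>\<nu>\<in>UNIV. A i \<nu> * Fr \<nu>)"
    and A: "\<And>\<nu>. (\<Sum>i\<in>UNIV. v i * A i \<nu>) = \<alpha>' \<nu>" and B: "\<And>\<nu>. (\<Sum>i\<in>UNIV. v i * B i \<nu>) = b \<nu>"
  shows "(\<Sum>i\<in>UNIV. v i * P' i)
    = (\<Sum>i\<in>UNIV. v i * (Tl i + Fl i)) + (\<Sum>\<nu>\<in>UNIV. \<alpha>' \<nu> * (Tr \<nu> + Fr \<nu>)) + (\<Sum>\<nu>\<in>UNIV. p \<nu> * b \<nu>)"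
proof -
  have swap: "(\<Sum>i\<in>UNIV. v i * (\<Sum>\<nu>\<in>UNIV. C i \<nu> * g \<nu>)) = (\<Sum>\<nu>\<in>UNIV. (\<Sum>i\<in>UNIV. v i * C i \<nu>) * g \<nu>)"
    for C :: "'m \<Rightarrow> 'k \<Rightarrow> real" and g
    unfolding sum_distrib_left sum_distrib_right by (subst sum.swap) (simp add: mult.assoc)
  have "P' i = (Tl i + Fl i) + (\<Sum>\<nu>\<in>UNIV. A i \<nu> * (Tr \<nu> + Fr \<nu>)) + (\<Sum>\<nu>\<in>UNIV. B i \<nu> * p \<nu>)" for i
    using eqs[of i] by (simp add: distrib_left sum.distrib mult.commute)
  then have "(\<Sum>i\<in>UNIV. v i * P' i) = (\<Sum>i\<in>UNIV. v i * (Tl i + Fl i))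
      + (\<Sum>i\<in>UNIV. v i * (\<Sum>\<nu>\<in>UNIV. A i \<nu> * (Tr \<nu> + Fr \<nu>)))
      + (\<Sum>i\<in>UNIV. v i * (\<Sum>\<nu>\<in>UNIV. B i \<nu> * p \<nu>))"
    by (simp add: distrib_left sum.distrib)
  moreover have "(\<Sum>\<nu>\<in>UNIV. b \<nu> * p \<nu>) = (\<Sum>\<nu>\<in>UNIV. p \<nu> * b \<nu>)"
    by (simp add: mult.commute)
  ultimately show ?thesis
    by (simp only: swap A B)
qed

lemma motion_has_derivatives:
  fixes q :: "real \<Rightarrow> real^('m::finite + 'k::finite)"
  assumes "open I" "C2_on I q" "t \<in> I"
  shows "(motion_velocity q has_vector_derivative motion_acceleration q t) (at t)"
    and "((motion_state q :: real \<Rightarrow> ('m, 'k) state) has_vector_derivative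
           (motion_velocity q t, indep_part (motion_acceleration q t), 1)) (at t)"
proof -
  have q: "(q has_vector_derivative motion_velocity q t) (at t)"
    using C2_on_differentiable[OF assms(2,3)]
    by (simp add: motion_velocity_def vector_derivative_works)
  have eq: "motion_velocity q \<tau> = dir_deriv 1 q \<tau>" if "\<tau> \<in> I" for \<tau>
    using dir_deriv_eq[of q "\<lambda>h. h *\<^sub>R motion_velocity q \<tau>" \<tau> 1] C2_on_differentiable[OF assms(2) that]
    by (simp add: motion_velocity_def vector_derivative_works has_vector_derivative_def)
  have "motion_velocity q differentiable (at t)"
    by (rule differentiable_cong_open[OF C2_on_dir_deriv_differentiable[OF assms(2,1,3), of 1] assms(1,3)])
       (simp add: eq)
  then show v: "(motion_velocity q has_vector_derivative motion_acceleration q t) (at t)"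
    by (simp add: motion_acceleration_def vector_derivative_works)
  have "bounded_linear (indep_part :: real^('m + 'k) \<Rightarrow> real^'m)"
    unfolding linear_conv_bounded_linear[symmetric]
    by (rule linearI) (auto simp: indep_part_def vec_eq_iff)
  then have "((\<lambda>\<tau>. indep_part (motion_velocity q \<tau>) :: real^'m) has_vector_derivative
      indep_part (motion_acceleration q t)) (at t)"
    using v by (rule bounded_linear.has_vector_derivative)
  with q show "((motion_state q :: real \<Rightarrow> ('m, 'k) state) has_vector_derivative
       (motion_velocity q t, indep_part (motion_acceleration q t), 1)) (at t)"
    unfolding motion_state_def[abs_def]
    by (intro has_vector_derivative_Pair has_vector_derivative_id)
qed

theorem proposition3:
  fixes M :: "'p::finite \<Rightarrow> real"
    and X :: "(real^('m::finite + 'k::finite)) \<times> real \<Rightarrow> 'p config"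
    and \<U> :: "'p config \<times> real \<Rightarrow> real"
    and F :: "'p config \<times> real \<Rightarrow> 'p config"
    and \<alpha> :: "'k \<Rightarrow> ('m, 'k) state \<Rightarrow> real"
    and q :: "real \<Rightarrow> (real^('m + 'k))"
    and Q :: "((real^('m + 'k)) \<times> real) set"
    and W :: "('p config \<times> real) set"
    and \<Omega> :: "('m, 'k) state set"
    and I :: "real set"
  assumes masses: "\<And>p. M p > 0"
    and domains: "open Q" "open W" "open \<Omega>"
      "\<And>x t. (x, t) \<in> Q \<Longrightarrow> (X (x, t), t) \<in> W"
      "\<And>x v t. (x, v, t) \<in> \<Omega> \<Longrightarrow> (x, t) \<in> Q"
    and smooth: "C2_on Q X" "C1_on W \<U>" "\<And>\<nu>. C2_on \<Omega> (\<alpha> \<nu>)"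
    and potential: "\<And>x t. (x, t) \<in> W \<Longrightarrow> GDERIV (\<lambda>y. \<U> (y, t)) x :> F (x, t)"
    and homogeneous: "\<And>\<nu> x v t. (x, v, t) \<in> \<Omega> \<Longrightarrow>
      (\<Sum>i\<in>UNIV. v $ i * D_v i (\<alpha> \<nu>) (x, v, t)) = \<alpha> \<nu> (x, v, t)"
    and motion: "open I" "is_interval I" "C2_on I q" "\<And>t. t \<in> I \<Longrightarrow> motion_state q t \<in> \<Omega>"
    and constraints: "\<And>t. t \<in> I \<Longrightarrow> satisfies_constraints \<alpha> q t"
    and motion_eqs: "\<And>t. t \<in> I \<Longrightarrow> satisfies_motion_eqs M X F \<alpha> q t"
    and "t \<in> I"
  shows "let L = restricted_lagrangian M X \<U> \<alpha> in
         ((\<lambda>\<tau>. (\<Sum>i\<in>UNIV. motion_velocity q \<tau> $ Inl i * D_v i L (motion_state q \<tau>))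
               - L (motion_state q \<tau>))
          has_real_derivative
            - D_t L (motion_state q t)
            + (\<Sum>\<nu>\<in>UNIV. dependent_momentum M X \<alpha> \<nu> (motion_state q t)
                          * D_t (\<alpha> \<nu>) (motion_state q t))) (at t)"
proof -
  define L where "L = restricted_lagrangian M X \<U> \<alpha>"
  define T where "T = restricted_kinetic_energy M X \<alpha>"
  define U :: "('m, 'k) state \<Rightarrow> real" where "U = potential_on_states X \<U>"
  define s :: "real \<Rightarrow> ('m, 'k) state" where "s = motion_state q"
  define v where "v = motion_velocity q t"
  define a :: "real^'m" where "a = indep_part (motion_acceleration q t)"
  define p where "p = (\<lambda>\<nu>. dependent_momentum M X \<alpha> \<nu> (s t))"

  have base: "(fst \<sigma>, snd (snd \<sigma>)) \<in> Q" if "\<sigma> \<in> \<Omega>" for \<sigma>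
    using domains(5)[of "fst \<sigma>" "fst (snd \<sigma>)" "snd (snd \<sigma>)"] that by simp
  have s_mem: "s \<tau> \<in> \<Omega>" if "\<tau> \<in> I" for \<tau>
    using motion(4)[OF that] by (simp add: s_def)
  have st: "s t = (q t, indep_part v, t)"
    by (simp add: s_def motion_state_def v_def)
  have s_mem_t: "(q t, indep_part v, t) \<in> \<Omega>"
    using s_mem[OF \<open>t \<in> I\<close>] by (simp add: st)

  have L_eq: "L = (\<lambda>\<sigma>. T \<sigma> + U \<sigma>)"
    by (auto simp: L_def T_def U_def restricted_lagrangian_def fun_eq_iff)
  have T_diff: "T differentiable (at \<sigma>)" and U_diff: "U differentiable (at \<sigma>)" if "\<sigma> \<in> \<Omega>" for \<sigma>
  proof -
    show "T differentiable (at \<sigma>)"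
      unfolding T_def
      by (rule restricted_kinetic_energy_differentiable[OF domains(1) smooth(1) base[OF that]
            C2_on_differentiable[OF smooth(3) that]])
    show "U differentiable (at \<sigma>)"
      unfolding U_def
      by (intro potential_differentiable C2_on_differentiable[OF smooth(1)]
          C1_on_differentiable[OF smooth(2)] domains(4) base that)
  qed
  have L_diff: "L differentiable (at \<sigma>)" if "\<sigma> \<in> \<Omega>" for \<sigma>
    unfolding L_eq by (intro differentiable_add T_diff U_diff that)
  have L_v: "D_v i L \<sigma> = D_v i T \<sigma>" if "\<sigma> \<in> \<Omega>" for i \<sigma>
    using dir_deriv_add[OF T_diff[OF that] U_diff[OF that]] D_v_potential[where X = X and \<U> = \<U> and i = i and s = \<sigma>]
    by (simp add: L_eq D_v_def U_def)
  have L_q: "D_q j L (s t) = D_q j T (s t) + gen_force F X j (q t, t)" for j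
  proof -
    have "(q t, t) \<in> Q"
      using domains(5)[OF s_mem_t] .
    then have "D_q j U (s t) = gen_force F X j (q t, t)"
      unfolding U_def st
      by (intro D_q_potential C2_on_differentiable[OF smooth(1)] potential domains(4))
    then show ?thesis
      using dir_deriv_add[OF T_diff U_diff, of "s t"] s_mem[OF \<open>t \<in> I\<close>] by (simp add: L_eq D_q_def)
  qed

  have s_der: "(s has_vector_derivative (v, a, 1)) (at t)"
    unfolding s_def v_def a_def by (rule motion_has_derivatives[OF motion(1,3) \<open>t \<in> I\<close>])
  have L_der: "((\<lambda>\<tau>. L (s \<tau>)) has_real_derivative
      (\<Sum>j\<in>UNIV. v $ j * D_q j L (s t)) + (\<Sum>i\<in>UNIV. a $ i * D_v i T (s t)) + D_t L (s t)) (at t)"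
    using dir_deriv_along_curve[OF s_der L_diff[OF s_mem[OF \<open>t \<in> I\<close>]]]
    by (simp add: has_real_derivative_iff_has_vector_derivative dir_deriv_coordinates
        L_diff[OF s_mem[OF \<open>t \<in> I\<close>]] L_v[OF s_mem[OF \<open>t \<in> I\<close>]])
  define P' where "P' i = deriv (\<lambda>\<tau>. D_v i T (s \<tau>)) t" for i
  have P_der: "((\<lambda>\<tau>. D_v i T (s \<tau>)) has_real_derivative P' i) (at t)" for i
  proof -
    have "D_v i T differentiable (at (s t))"
      unfolding T_def using domains(1) smooth(1) domains(3) smooth(3) base s_mem[OF \<open>t \<in> I\<close>]
      by (rule restricted_momentum_differentiable)
    from dir_deriv_along_curve[OF s_der this] show ?thesis
      unfolding P'_def has_real_derivative_iff_has_vector_derivative[symmetric]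
      by (simp add: DERIV_imp_deriv)
  qed
  have v_der: "((\<lambda>\<tau>. motion_velocity q \<tau> $ Inl i) has_real_derivative a $ i) (at t)" for i
    using bounded_linear.has_vector_derivative[OF bounded_linear_vec_nth[of "Inl i"]
        motion_has_derivatives(1)[OF motion(1,3) \<open>t \<in> I\<close>]]
    by (simp add: has_real_derivative_iff_has_vector_derivative a_def indep_part_def)
  \<comment> \<open>The energy is differentiated with \<open>\<partial>T\<^sup>*/\<partial>v\<^sub>i\<close> in place of \<open>\<partial>L\<^sup>*/\<partial>v\<^sub>i\<close>, the form in which the
      equations of motion supply the time derivative; the two agree at all states of the motion.\<close>
  have "((\<lambda>\<tau>. (\<Sum>i\<in>UNIV. motion_velocity q \<tau> $ Inl i * D_v i T (s \<tau>)) - L (s \<tau>)) has_real_derivative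
      (\<Sum>i\<in>UNIV. a $ i * D_v i T (s t) + P' i * motion_velocity q t $ Inl i)
      - ((\<Sum>j\<in>UNIV. v $ j * D_q j L (s t)) + (\<Sum>i\<in>UNIV. a $ i * D_v i T (s t)) + D_t L (s t))) (at t)"
    by (intro DERIV_diff DERIV_sum DERIV_mult v_der P_der L_der)
  moreover have "(\<Sum>i\<in>UNIV. a $ i * D_v i T (s t) + P' i * motion_velocity q t $ Inl i)
      - ((\<Sum>j\<in>UNIV. v $ j * D_q j L (s t)) + (\<Sum>i\<in>UNIV. a $ i * D_v i T (s t)) + D_t L (s t))
      = - D_t L (s t) + (\<Sum>\<nu>\<in>UNIV. p \<nu> * D_t (\<alpha> \<nu>) (s t))"
  proof -
    have "(\<Sum>i\<in>UNIV. v $ Inl i * P' i)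
      = (\<Sum>i\<in>UNIV. v $ Inl i * (D_q (Inl i) T (s t) + gen_force F X (Inl i) (q t, t)))
      + (\<Sum>\<nu>\<in>UNIV. v $ Inr \<nu> * (D_q (Inr \<nu>) T (s t) + gen_force F X (Inr \<nu>) (q t, t)))
      + (\<Sum>\<nu>\<in>UNIV. p \<nu> * D_t (\<alpha> \<nu>) (s t))"
    proof (rule power_balance[where A = "\<lambda>i \<nu>. D_v i (\<alpha> \<nu>) (s t)" and B = "\<lambda>i \<nu>. B_coeff \<alpha> i \<nu> (s t) a"])
      show "P' i - D_q (Inl i) T (s t) - (\<Sum>\<nu>\<in>UNIV. D_q (Inr \<nu>) T (s t) * D_v i (\<alpha> \<nu>) (s t))
          - (\<Sum>\<nu>\<in>UNIV. B_coeff \<alpha> i \<nu> (s t) a * p \<nu>)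
          = gen_force F X (Inl i) (q t, t) + (\<Sum>\<nu>\<in>UNIV. D_v i (\<alpha> \<nu>) (s t) * gen_force F X (Inr \<nu>) (q t, t))" for i
        using motion_eqs[OF \<open>t \<in> I\<close>]
        by (simp add: satisfies_motion_eqs_def Let_def P'_def T_def s_def a_def p_def)
      have Inl: "v $ Inl i = indep_part v $ i" for i
        by (simp add: indep_part_def)
      show "(\<Sum>i\<in>UNIV. v $ Inl i * D_v i (\<alpha> \<nu>) (s t)) = v $ Inr \<nu>" for \<nu>
        using constraints[OF \<open>t \<in> I\<close>] homogeneous[OF s_mem_t, of \<nu>]
        by (simp add: satisfies_constraints_def Inl st[symmetric])
           (simp add: s_def v_def)
      show "(\<Sum>i\<in>UNIV. v $ Inl i * B_coeff \<alpha> i \<nu> (s t) a) = D_t (\<alpha> \<nu>) (s t)" for \<nu>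
        unfolding Inl st
        by (rule velocity_contracted_B_coeff[OF domains(3) smooth(3) homogeneous homogeneous[OF s_mem_t] s_mem_t])
    qed
    then show ?thesis
      by (simp add: sum.distrib sum_over_sum_type L_q v_def mult.commute)
  qed
  ultimately have der: "((\<lambda>\<tau>. (\<Sum>i\<in>UNIV. motion_velocity q \<tau> $ Inl i * D_v i T (s \<tau>)) - L (s \<tau>))
      has_real_derivative - D_t L (s t) + (\<Sum>\<nu>\<in>UNIV. p \<nu> * D_t (\<alpha> \<nu>) (s t))) (at t)"
    by simp
  have "((\<lambda>\<tau>. (\<Sum>i\<in>UNIV. motion_velocity q \<tau> $ Inl i * D_v i L (s \<tau>)) - L (s \<tau>))
      has_real_derivative - D_t L (s t) + (\<Sum>\<nu>\<in>UNIV. p \<nu> * D_t (\<alpha> \<nu>) (s t))) (at t)"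
    by (rule has_field_derivative_transform_within_open[OF der motion(1) \<open>t \<in> I\<close>])
       (simp add: L_v s_mem)
  then show ?thesis
    by (simp add: Let_def L_def s_def p_def)
qed

end
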